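(* Let $A\in\mathscr{G}$ be of finite order $n\neq2$. Then $A$ is conjugate in $\mathscr{G}$ to a rotation $$R_\theta=\begin{bmatrix}1&0\\0&e^{\mathbf{i}\theta}\end{bmatrix}$$ for some angle $\theta$.
   Context: For a matrix $A$ with entries in $\mathbb{C}(z)$, $\bar A$ is obtained by conjugating all coefficients of the entries; this also makes sense in $\mathrm{PGL}(2,\mathbb{C}(z))$. $\tau=\left[\begin{smallmatrix}0&1-z^2\\1&0\end{smallmatrix}\right]$ and $\mathscr{G}=\{A\in\mathrm{PGL}(2,\mathbb{C}(z))\mid\tau A\tau=\bar A\}$. (For the sphere $S$: $w^2=x^2+y^2+z^2$ and $\pi\colon S\dashrightarrow\mathbb{P}^1$, $(w:x:y:z)\mapsto(w:z)$, the group $\mathscr{G}$ is identified with the group $\mathrm{Bir}(S/\pi)$ of real birational maps $g$ of $S$ with $\pi g=\pi$, via the birational map $\psi\colon S_{\mathbb{C}}\dashrightarrow\mathbb{A}^2_{\mathbb{C}}$, $(x,y,z)\mapsto(x-\mathbf{i}y,z)$, and the action of $\left[\begin{smallmatrix}\alpha&\beta\\\gamma&\delta\end{smallmatrix}\right]$ on $\mathbb{A}^2_{\mathbb{C}}$ by $(t,z)\mapsto\left(\frac{\alpha t+\beta}{\gamma t+\delta},z\right)$; $R_\theta$ corresponds to the rotation $(x,y,z)\mapsto(x\cos\theta-y\sin\theta,x\sin\theta+y\cos\theta,z)$.) *)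

theory Defs
  imports
    "HOL-Analysis.Analysis"
    "HOL-Computational_Algebra.Fraction_Field"
    "HOL-Computational_Algebra.Polynomial"
    "HOL-Algebra.Multiplicative_Group"
begin

section \<open>Coefficientwise conjugation on \<open>\<complex>(z)\<close>\<close>

type_synonym ratfun = "complex poly fract"

lemma map_poly_cnj_mult:
  "map_poly cnj (p * q) = map_poly cnj p * map_poly cnj q"
  by (intro poly_eqI) (simp add: coeff_map_poly coeff_mult)

lemma map_poly_cnj_add:
  "map_poly cnj (p + q) = map_poly cnj p + map_poly cnj q"
  by (intro poly_eqI) (simp add: coeff_map_poly)

lemma map_poly_cnj_eq_0_iff [simp]: "map_poly cnj p = 0 \<longleftrightarrow> p = 0"
  by (rule map_poly_eq_0_iff) auto

lift_definition conj_ratfun :: "ratfun \<Rightarrow> ratfun"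
  is "\<lambda>(p, q). (map_poly cnj p, map_poly cnj q)"
  by (auto simp: map_poly_cnj_mult [symmetric])

lemma conj_ratfun_Fract [simp]:
  "conj_ratfun (Fract p q) = Fract (map_poly cnj p) (map_poly cnj q)"
  by transfer auto

lemma conj_ratfun_0 [simp]: "conj_ratfun 0 = 0"
  by (simp add: Zero_fract_def)

lemma conj_ratfun_1 [simp]: "conj_ratfun 1 = 1"
  by (simp add: One_fract_def)

lemma conj_ratfun_add [simp]: "conj_ratfun (x + y) = conj_ratfun x + conj_ratfun y"
  by (cases x; cases y) (simp add: map_poly_cnj_add map_poly_cnj_mult)

lemma conj_ratfun_mult [simp]: "conj_ratfun (x * y) = conj_ratfun x * conj_ratfun y"
  by (cases x; cases y) (simp add: map_poly_cnj_mult)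

lemma conj_ratfun_conj_ratfun [simp]: "conj_ratfun (conj_ratfun x) = x"
  by (cases x) (simp add: map_poly_map_poly o_def)

lemma conj_ratfun_eq_0_iff [simp]: "conj_ratfun x = 0 \<longleftrightarrow> x = 0"
  by (metis conj_ratfun_0 conj_ratfun_conj_ratfun)


section \<open>\<open>PGL(2, K)\<close> as the quotient of \<open>GL(2, K)\<close> by the scalar matrices\<close>

definition GL2 :: "('a :: field ^ 2 ^ 2) monoid" where
  "GL2 = \<lparr>carrier = {A. invertible A}, mult = (**), one = mat 1\<rparr>"

definition scalars2 :: "('a :: field ^ 2 ^ 2) set" where
  "scalars2 = {mat c | c. c \<noteq> 0}"

definition PGL2 :: "('a :: field ^ 2 ^ 2) set monoid" where
  "PGL2 = GL2 Mod scalars2"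

definition pgl_class :: "'a :: field ^ 2 ^ 2 \<Rightarrow> ('a ^ 2 ^ 2) set" where
  "pgl_class A = scalars2 #>\<^bsub>GL2\<^esub> A"

definition mat2 :: "'a :: zero \<Rightarrow> 'a \<Rightarrow> 'a \<Rightarrow> 'a \<Rightarrow> 'a ^ 2 ^ 2" where
  "mat2 a b c d = vector [vector [a, b], vector [c, d]]"

lemma group_GL2: "group (GL2 :: ('a :: field ^ 2 ^ 2) monoid)"
proof (rule groupI)
  fix A :: "'a ^ 2 ^ 2"
  assume "A \<in> carrier GL2"
  then obtain B where "A ** B = mat 1" "B ** A = mat 1"
    by (auto simp: GL2_def invertible_def)
  then show "\<exists>B\<in>carrier GL2. B \<otimes>\<^bsub>GL2\<^esub> A = \<one>\<^bsub>GL2\<^esub>"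
    by (auto simp: GL2_def invertible_def)
next
  have "invertible (mat 1 :: 'a ^ 2 ^ 2)"
    unfolding invertible_def by (metis matrix_mul_lid)
  then show "\<one>\<^bsub>GL2\<^esub> \<in> carrier (GL2 :: ('a ^ 2 ^ 2) monoid)"
    by (simp add: GL2_def)
qed (auto simp: GL2_def invertible_mult matrix_mul_assoc matrix_mul_lid)

lemma mat_mult_mat: "(mat a :: 'a :: field ^ 2 ^ 2) ** mat b = mat (a * b)"
  by (simp add: matrix_matrix_mult_def mat_def vec_eq_iff forall_2 sum_2)

lemma mat_mult_commute: "(mat a :: 'a :: field ^ 2 ^ 2) ** B = B ** mat a"
  by (simp add: matrix_matrix_mult_def mat_def vec_eq_iff if_distrib if_distribR mult.commute
      cong: if_cong)

lemma invertible_mat: "a \<noteq> 0 \<Longrightarrow> invertible (mat a :: 'a :: field ^ 2 ^ 2)"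
  unfolding invertible_def
  by (rule exI [of _ "mat (inverse a)"]) (simp add: mat_mult_mat)

lemma scalars2_normal: "scalars2 \<lhd> (GL2 :: ('a :: field ^ 2 ^ 2) monoid)"
proof -
  interpret group "GL2 :: ('a ^ 2 ^ 2) monoid" by (rule group_GL2)
  have "subgroup scalars2 (GL2 :: ('a ^ 2 ^ 2) monoid)"
  proof (rule subgroupI)
    fix A :: "'a ^ 2 ^ 2"
    assume "A \<in> scalars2"
    then obtain c where c: "A = mat c" "c \<noteq> 0"
      by (auto simp: scalars2_def)
    have "inv\<^bsub>GL2\<^esub> A = mat (inverse c)"
      by (rule inv_equality) (auto simp: c GL2_def mat_mult_mat invertible_mat)
    then show "inv\<^bsub>GL2\<^esub> A \<in> scalars2"
      using c by (auto simp: scalars2_def)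
  next
    fix A B :: "'a ^ 2 ^ 2"
    assume "A \<in> scalars2" "B \<in> scalars2"
    then obtain a b where "A = mat a" "a \<noteq> 0" "B = mat b" "b \<noteq> 0"
      by (auto simp: scalars2_def)
    then show "A \<otimes>\<^bsub>GL2\<^esub> B \<in> scalars2"
      unfolding scalars2_def GL2_def
      by (auto simp: mat_mult_mat intro!: exI [of _ "a * b"])
  next
    show "(scalars2 :: ('a ^ 2 ^ 2) set) \<noteq> {}"
      by (auto simp: scalars2_def intro: exI [of _ 1])
  qed (auto simp: scalars2_def GL2_def invertible_mat)
  then show ?thesis
    by (rule normalI) (auto simp: r_coset_def l_coset_def scalars2_def GL2_def mat_mult_commute)
qed

lemma group_PGL2: "group (PGL2 :: ('a :: field ^ 2 ^ 2) set monoid)"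
  unfolding PGL2_def by (rule normal.factorgroup_is_group [OF scalars2_normal])

lemma pgl_class_eq: "pgl_class A = {mat c ** A | c. c \<noteq> 0}"
  by (auto simp: pgl_class_def r_coset_def scalars2_def GL2_def)

lemma carrier_PGL2: "carrier PGL2 = {pgl_class A | A. invertible A}"
  by (auto simp: PGL2_def carrier_FactGroup pgl_class_def GL2_def)

lemma mult_PGL2:
  assumes "invertible A" "invertible B"
  shows "pgl_class A \<otimes>\<^bsub>PGL2\<^esub> pgl_class B = pgl_class (A ** B)"
  using normal.rcos_sum [OF scalars2_normal, of A B] assms
  by (simp add: PGL2_def pgl_class_def GL2_def)

lemma one_PGL2: "\<one>\<^bsub>PGL2\<^esub> = pgl_class (mat 1)"
  by (simp add: PGL2_def pgl_class_eq scalars2_def)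


section \<open>The group \<open>\<G>\<close>\<close>

definition conj_mat :: "ratfun ^ 2 ^ 2 \<Rightarrow> ratfun ^ 2 ^ 2" where
  "conj_mat A = (\<chi> i j. conj_ratfun (A $ i $ j))"

text \<open>The conjugate of a class is its image under conjugation of representatives;
  that this is again a class is \<open>conj_pgl_class\<close> below.\<close>

definition conj_pgl :: "(ratfun ^ 2 ^ 2) set \<Rightarrow> (ratfun ^ 2 ^ 2) set" where
  "conj_pgl X = conj_mat ` X"

definition tau :: "(ratfun ^ 2 ^ 2) set" where
  "tau = pgl_class (mat2 0 (Fract [:1, 0, -1:] 1) 1 0)"

definition scrG :: "(ratfun ^ 2 ^ 2) set monoid" where
  "scrG = PGL2\<lparr>carrier :=
     {A \<in> carrier PGL2. tau \<otimes>\<^bsub>PGL2\<^esub> A \<otimes>\<^bsub>PGL2\<^esub> tau = conj_pgl A}\<rparr>"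

definition rotation :: "real \<Rightarrow> (ratfun ^ 2 ^ 2) set" where
  "rotation \<theta> = pgl_class (mat2 1 0 0 (Fract [:exp (\<i> * of_real \<theta>):] 1))"

lemma conj_mat_mult: "conj_mat (A ** B) = conj_mat A ** conj_mat B"
  by (simp add: conj_mat_def matrix_matrix_mult_def vec_eq_iff sum_2)

lemma conj_mat_mat: "conj_mat (mat c) = mat (conj_ratfun c)"
  by (simp add: conj_mat_def mat_def vec_eq_iff)

lemma conj_mat_mat2:
  "conj_mat (mat2 a b c d) =
     mat2 (conj_ratfun a) (conj_ratfun b) (conj_ratfun c) (conj_ratfun d)"
  by (simp add: conj_mat_def mat2_def vec_eq_iff forall_2)

lemma invertible_conj_mat: "invertible A \<Longrightarrow> invertible (conj_mat A)"
  unfolding invertible_def by (metis conj_mat_mult conj_mat_mat conj_ratfun_1)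

lemma conj_pgl_class: "conj_pgl (pgl_class A) = pgl_class (conj_mat A)"
proof -
  have "conj_mat (mat c ** A) \<in> {mat c ** conj_mat A | c. c \<noteq> 0}" if "c \<noteq> 0" for c
    using that by (auto simp: conj_mat_mult conj_mat_mat intro!: exI [of _ "conj_ratfun c"])
  moreover have "mat c ** conj_mat A \<in> conj_mat ` {mat c ** A | c. c \<noteq> 0}" if "c \<noteq> 0" for c
    using that
    by (intro image_eqI [of _ _ "mat (conj_ratfun c) ** A"])
       (auto simp: conj_mat_mult conj_mat_mat intro!: exI [of _ "conj_ratfun c"])
  ultimately show ?thesis
    unfolding conj_pgl_def pgl_class_eq by blast
qed

lemma mat2_mult:
  "mat2 a b c d ** mat2 a' b' c' d' =
     (mat2 (a * a' + b * c') (a * b' + b * d') (c * a' + d * c') (c * b' + d * d')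
       :: 'a :: field ^ 2 ^ 2)"
  by (simp add: mat2_def matrix_matrix_mult_def vec_eq_iff forall_2 sum_2)

lemma mat_eq_mat2: "(mat a :: 'a :: field ^ 2 ^ 2) = mat2 a 0 0 a"
  by (simp add: mat2_def mat_def vec_eq_iff forall_2)

lemma det_mat2: "det (mat2 a b c d :: 'a :: field ^ 2 ^ 2) = a * d - b * c"
  by (simp add: det_2 mat2_def)

lemma invertible_mat2:
  "invertible (mat2 a b c d :: 'a :: field ^ 2 ^ 2) \<longleftrightarrow> a * d - b * c \<noteq> 0"
  by (simp add: invertible_det_nz det_mat2)

lemma pgl_class_mat: "(c :: 'a :: field) \<noteq> 0 \<Longrightarrow> pgl_class (mat c) = \<one>\<^bsub>PGL2\<^esub>"
proof -
  assume c: "c \<noteq> 0"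
  have "(mat d :: 'a ^ 2 ^ 2) \<in> {mat e ** mat c | e. e \<noteq> 0}" if "d \<noteq> 0" for d :: 'a
    using c that by (auto simp: mat_mult_mat intro!: exI [of _ "d / c"])
  moreover have "(mat e ** mat c :: 'a ^ 2 ^ 2) \<in> {mat d ** mat 1 | d. d \<noteq> 0}" if "e \<noteq> 0" for e :: 'a
    using c that by (auto simp: mat_mult_mat intro!: exI [of _ "e * c"])
  ultimately show ?thesis
    unfolding one_PGL2 pgl_class_eq by (auto simp: mat_mult_mat)
qed

lemma tau_nz: "Fract [:1, 0, -1 :: complex:] 1 \<noteq> 0"
  by (simp add: Zero_fract_def eq_fract)

lemma invertible_tau: "invertible (mat2 0 (Fract [:1, 0, -1 :: complex:] 1) 1 0)"
  unfolding invertible_mat2 using tau_nz by (simp del: minus_fract)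

lemma tau_closed: "tau \<in> carrier PGL2"
  using invertible_tau unfolding tau_def carrier_PGL2 by blast

lemma tau_tau: "tau \<otimes>\<^bsub>PGL2\<^esub> tau = \<one>\<^bsub>PGL2\<^esub>"
proof -
  define f :: ratfun where "f = Fract [:1, 0, -1:] 1"
  have f: "f \<noteq> 0" "tau = pgl_class (mat2 0 f 1 0)" "invertible (mat2 0 f 1 0)"
    using tau_nz invertible_tau by (simp_all add: f_def tau_def)
  have "tau \<otimes>\<^bsub>PGL2\<^esub> tau = pgl_class (mat2 0 f 1 0 ** mat2 0 f 1 0)"
    unfolding f(2) using f(3) by (rule mult_PGL2 [OF f(3)])
  then have "tau \<otimes>\<^bsub>PGL2\<^esub> tau = pgl_class (mat f)"
    by (simp add: mat2_mult mat_eq_mat2)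
  with f show ?thesis by (simp add: pgl_class_mat)
qed

lemma conj_pgl_hom:
  assumes "A \<in> carrier PGL2" "B \<in> carrier PGL2"
  shows "conj_pgl (A \<otimes>\<^bsub>PGL2\<^esub> B) = conj_pgl A \<otimes>\<^bsub>PGL2\<^esub> conj_pgl B"
  using assms
  by (auto simp: carrier_PGL2 mult_PGL2 conj_pgl_class conj_mat_mult invertible_conj_mat)

lemma conj_pgl_closed: "A \<in> carrier PGL2 \<Longrightarrow> conj_pgl A \<in> carrier PGL2"
  by (auto simp: carrier_PGL2 conj_pgl_class invertible_conj_mat)

lemma subgroup_scrG: "subgroup (carrier scrG) PGL2"
proof -
  interpret group "PGL2 :: (ratfun ^ 2 ^ 2) set monoid" by (rule group_PGL2)
  define f where "f A = tau \<otimes>\<^bsub>PGL2\<^esub> A \<otimes>\<^bsub>PGL2\<^esub> tau" for A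
  have inv_tau: "inv\<^bsub>PGL2\<^esub> tau = tau"
    by (rule inv_equality [OF tau_tau tau_closed tau_closed])
  have f_closed: "f A \<in> carrier PGL2" if "A \<in> carrier PGL2" for A
    using that tau_closed by (simp add: f_def)
  have f_hom: "f (A \<otimes>\<^bsub>PGL2\<^esub> B) = f A \<otimes>\<^bsub>PGL2\<^esub> f B"
    if "A \<in> carrier PGL2" "B \<in> carrier PGL2" for A B
  proof -
    have "f A \<otimes>\<^bsub>PGL2\<^esub> f B =
        tau \<otimes>\<^bsub>PGL2\<^esub> A \<otimes>\<^bsub>PGL2\<^esub> (tau \<otimes>\<^bsub>PGL2\<^esub> tau) \<otimes>\<^bsub>PGL2\<^esub> B \<otimes>\<^bsub>PGL2\<^esub> tau"
      using that tau_closed by (simp only: f_def m_assoc m_closed)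
    then show ?thesis
      using that tau_closed by (simp add: f_def tau_tau m_assoc)
  qed
  have gf: "group_hom PGL2 PGL2 f" and gc: "group_hom PGL2 PGL2 conj_pgl"
    using f_closed f_hom conj_pgl_closed conj_pgl_hom
    by (auto simp: group_hom_def group_hom_axioms_def hom_def group_PGL2)
  have car: "carrier scrG = {A \<in> carrier PGL2. f A = conj_pgl A}"
    by (simp add: scrG_def f_def)
  show ?thesis
  proof (rule subgroupI)
    show "carrier scrG \<noteq> {}"
      unfolding car using group_hom.hom_one [OF gf] group_hom.hom_one [OF gc] by force
  next
    fix A assume "A \<in> carrier scrG"
    then show "inv\<^bsub>PGL2\<^esub> A \<in> carrier scrG"
      using group_hom.hom_inv [OF gf] group_hom.hom_inv [OF gc] by (simp add: car)
  next
    fix A B assume "A \<in> carrier scrG" "B \<in> carrier scrG"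
    then show "A \<otimes>\<^bsub>PGL2\<^esub> B \<in> carrier scrG"
      by (simp add: car f_hom conj_pgl_hom)
  qed (simp add: car)
qed

lemma group_scrG: "group scrG"
proof -
  interpret group "PGL2 :: (ratfun ^ 2 ^ 2) set monoid" by (rule group_PGL2)
  have "scrG = PGL2\<lparr>carrier := carrier scrG\<rparr>"
    by (simp add: scrG_def)
  then show ?thesis
    using subgroup.subgroup_is_group [OF subgroup_scrG is_group] by simp
qed

end

theory Submission
  imports Defs "HOL-Computational_Algebra.Fundamental_Theorem_Algebra"
begin

text \<open>
  Write \<open>h = 1 - z\<^sup>2\<close>.  An invertible matrix with rows \<open>a, b\<close> and \<open>c, d\<close> represents an element of \<open>\<G>\<close> iff
  \<open>d = s \<cdot> conj a\<close> and \<open>b = h \<cdot> s \<cdot> conj c\<close> for some \<open>s\<close> with \<open>s \<cdot> conj s = 1\<close>.  By Hilbert 90, here for the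
  quadratic extension \<open>\<complex>(z)\<close> of \<open>\<real>(z)\<close>, rescaling the matrix makes \<open>s = 1\<close> (\<open>scrG_imp_quat\<close>).  So
  \<open>\<G>\<close> is the group of units, modulo \<open>\<real>(z)\<close>-scalars, of the quaternion algebra \<open>\<complex>(z) + j \<complex>(z)\<close>
  over \<open>\<real>(z)\<close> with \<open>j\<^sup>2 = h\<close> and \<open>x j = j conj x\<close>.  This is a division algebra: its norm form
  \<open>a conj a - h c conj c\<close> is anisotropic, because on the half-line \<open>z > 1\<close>, where \<open>h\<close> is negative, it is
  a sum of two nonnegative terms (\<open>norm_form_anisotropic\<close>).

  Let \<open>M\<close> be a quaternion whose class has finite order.  If \<open>M\<close> has trace \<open>0\<close>, then \<open>M\<^sup>2\<close> is scalar and
  the order divides \<open>2\<close>.  Otherwise scale \<open>M\<close> to trace \<open>2\<close>, so that \<open>M\<^sup>2 = 2 M - \<nu>\<close> with \<open>\<nu>\<close> the norm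
  of \<open>M\<close>.  The powers of \<open>M\<close> are then combinations of \<open>M\<close> and \<open>1\<close> whose coefficients are fixed
  polynomials in \<open>\<nu>\<close>.  If \<open>M\<^sup>n\<close> is scalar and \<open>M\<close> is not, then one of these nonzero polynomials
  vanishes at \<open>\<nu>\<close>, so \<open>\<nu>\<close> is algebraic over \<open>\<complex>\<close> and therefore a constant
  (\<open>finite_order_imp_constant_norm\<close>); it is real since norms lie in \<open>\<real>(z)\<close>.

  Now \<open>(M - 1)\<^sup>2 = 1 - \<nu>\<close>.  If \<open>\<nu> \<le> 1\<close>, then \<open>1 - \<nu>\<close> is a square in \<open>\<real>\<close>, and in a division algebra
  \<open>M - 1\<close> is one of its real square roots, which makes \<open>M\<close> scalar.  Otherwise \<open>1 - \<nu> = (\<i> k)\<^sup>2\<close> with \<open>k\<close> real.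
  Two square roots of the same central element are conjugate (Skolem and Noether), here by an
  explicit quaternion (\<open>quat_conjugate_to_constant\<close>), so \<open>M\<close> is conjugate to \<open>1 + \<i> k\<close>, the diagonal
  matrix with entries \<open>1 + \<i> k\<close> and \<open>1 - \<i> k\<close>.  The quotient of these has modulus \<open>1\<close>, and that is a rotation.
\<close>

section \<open>Constants in \<open>\<complex>(z)\<close> and algebraic elements\<close>

lemma conj_ratfun_uminus [simp]: "conj_ratfun (- x) = - conj_ratfun x"
  using conj_ratfun_add [of x "- x"] by (simp add: eq_neg_iff_add_eq_0 add.commute)

lemma conj_ratfun_diff [simp]: "conj_ratfun (x - y) = conj_ratfun x - conj_ratfun y"
  using conj_ratfun_add [of x "- y"] by simp

lemma conj_ratfun_divide [simp]: "conj_ratfun (x / y) = conj_ratfun x / conj_ratfun y"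
proof (cases "y = 0")
  case False
  then show ?thesis using conj_ratfun_mult [of "x / y" y] by (simp add: eq_divide_eq)
qed simp

definition cst :: "complex \<Rightarrow> ratfun" where
  "cst c = Fract [:c:] 1"

lemma cst_0 [simp]: "cst 0 = 0"
  by (simp add: cst_def Zero_fract_def)

lemma cst_1 [simp]: "cst 1 = 1"
  by (simp add: cst_def One_fract_def one_pCons)

lemma cst_add: "cst (a + b) = cst a + cst b"
  by (simp add: cst_def)

lemma cst_mult: "cst (a * b) = cst a * cst b"
  by (simp add: cst_def mult.commute)

lemma cst_eq_iff [simp]: "cst a = cst b \<longleftrightarrow> a = b"
  by (simp add: cst_def eq_fract)

lemma cst_2: "cst 2 = 2"
  using cst_add [of 1 1] by simp

lemma cst_uminus: "cst (- a) = - cst a"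
  by (simp add: cst_def)

lemma conj_cst [simp]: "conj_ratfun (cst c) = cst (cnj c)"
  by (simp add: cst_def map_poly_pCons)

text \<open>Evaluation at a rational function of a polynomial in a new variable: the coefficients
  are complex numbers, and the variable is not the \<open>z\<close> of \<open>\<complex>(z)\<close>.\<close>

definition ev :: "complex poly \<Rightarrow> ratfun \<Rightarrow> ratfun" where
  "ev p x = poly (map_poly cst p) x"

lemma ev_0 [simp]: "ev 0 x = 0"
  by (simp add: ev_def)

lemma ev_pCons [simp]: "ev (pCons a p) x = cst a + x * ev p x"
  by (simp add: ev_def map_poly_pCons)

lemma ev_add: "ev (p + q) x = ev p x + ev q x"
proof (induction p arbitrary: q)
  case (pCons a p)
  then show ?case by (cases q) (simp add: cst_add algebra_simps)
qed simp

lemma ev_smult: "ev (Polynomial.smult c p) x = cst c * ev p x"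
  by (induction p) (simp_all add: cst_mult algebra_simps)

text \<open>Since \<open>\<complex>\<close> is algebraically closed, a polynomial over \<open>\<complex>\<close> splits into linear factors \<open>X - c\<close>.
  If the product vanishes at \<open>x\<close>, then so does one of the factors, as \<open>\<complex>(z)\<close> has no zero divisors.\<close>

lemma root_imp_constant:
  assumes "p \<noteq> 0" "ev p x = 0"
  shows "\<exists>c. x = cst c"
  using assms
proof (induction "degree p" arbitrary: p rule: less_induct)
  case less
  have "\<not> constant (poly p)"
  proof
    assume "constant (poly p)"
    then obtain a where "p = [:a:]" by (metis constant_degree degree_eq_zeroE)
    then show False using less.prems cst_eq_iff [of a 0] by simp
  qed
  then obtain c where "poly p c = 0" using fundamental_theorem_of_algebra by blast
  then obtain q where q: "p = [:- c, 1:] * q" by (metis dvdE poly_eq_0_iff_dvd)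
  then have "q \<noteq> 0" and deg: "degree q < degree p"
    using less.prems by (auto simp: degree_mult_eq simp del: mult_pCons_left)
  have "p = Polynomial.smult (- c) q + pCons 0 q" by (simp add: q)
  then have "ev p x = cst (- c) * ev q x + (cst 0 + x * ev q x)"
    by (simp only: ev_add ev_smult ev_pCons)
  then have "ev p x = (x - cst c) * ev q x"
    by (simp add: cst_uminus algebra_simps)
  then show ?case using less \<open>q \<noteq> 0\<close> deg by auto
qed

section \<open>Anisotropy of the norm form\<close>

definition h :: ratfun where
  "h = Fract [:1, 0, -1:] 1"

lemma h_nonzero [simp]: "h \<noteq> 0"
  using tau_nz by (simp add: h_def del: minus_fract)

lemma conj_h [simp]: "conj_ratfun h = h"
  by (simp add: h_def map_poly_pCons)

lemma poly_map_poly_cnj_of_real: "poly (map_poly cnj p) (of_real t) = cnj (poly p (of_real t))"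
  by (induction p) (simp_all add: map_poly_pCons)

text \<open>At a real point \<open>t > 1\<close> the equation reads \<open>\<bar>p(t)\<bar>\<^sup>2 = (1 - t\<^sup>2) \<bar>r(t)\<bar>\<^sup>2\<close> with a negative factor
  \<open>1 - t\<^sup>2\<close>, so both polynomials vanish at infinitely many points.\<close>

lemma poly_norm_form_anisotropic:
  assumes eq: "p * map_poly cnj p = [:1, 0, -1:] * (r * map_poly cnj r)"
  shows "p = 0 \<and> r = 0"
proof -
  have zero: "poly p (of_real t) = 0 \<and> poly r (of_real t) = 0" if "t > 1" for t :: real
  proof -
    let ?P = "poly p (of_real t)" and ?R = "poly r (of_real t)"
    have "?P * cnj ?P = (1 - of_real t ^ 2) * (?R * cnj ?R)"
      using arg_cong [OF eq, of "\<lambda>q. poly q (of_real t)"]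
      by (simp add: poly_map_poly_cnj_of_real power2_eq_square algebra_simps)
    then have "complex_of_real ((cmod ?P)\<^sup>2) = of_real ((1 - t\<^sup>2) * (cmod ?R)\<^sup>2)"
      by (simp only: complex_norm_square of_real_mult of_real_diff of_real_1)
        (simp only: of_real_power)
    then have *: "(cmod ?P)\<^sup>2 = (1 - t\<^sup>2) * (cmod ?R)\<^sup>2"
      by (simp only: of_real_eq_iff)
    have neg: "1 - t\<^sup>2 < 0" using that by (simp add: power2_eq_square less_1_mult)
    have "(1 - t\<^sup>2) * (cmod ?R)\<^sup>2 \<le> 0" using neg by (simp add: mult_nonpos_nonneg)
    then have "(cmod ?P)\<^sup>2 = 0" using * by (metis antisym zero_le_power2)
    then show ?thesis using * neg by auto
  qed
  have inf: "infinite (complex_of_real ` {1<..})"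
    by (simp add: finite_image_iff inj_on_def infinite_Ioi)
  have "q = 0" if "\<And>t :: real. t > 1 \<Longrightarrow> poly q (of_real t) = 0" for q :: "complex poly"
  proof (rule ccontr)
    assume "q \<noteq> 0"
    then have "finite {x. poly q x = 0}" by (rule poly_roots_finite)
    moreover have "complex_of_real ` {1<..} \<subseteq> {x. poly q x = 0}" using that by auto
    ultimately show False using inf finite_subset by blast
  qed
  with zero show ?thesis by blast
qed

lemma norm_form_anisotropic:
  assumes eq: "a * conj_ratfun a = h * (c * conj_ratfun c)"
  shows "a = 0 \<and> c = 0"
proof -
  obtain p1 q1 where a: "a = Fract p1 q1" "q1 \<noteq> 0" by (cases a)
  obtain p2 q2 where c: "c = Fract p2 q2" "q2 \<noteq> 0" by (cases c)
  \<comment> \<open>numerators over the common denominator \<open>q1 q2\<close>\<close>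
  define p r where "p = p1 * q2" and "r = p2 * q1"
  \<comment> \<open>an opaque name, so that products with \<open>1 - z\<^sup>2\<close> are not multiplied out\<close>
  define k :: "complex poly" where "k = [:1, 0, -1:]"
  have "h = Fract k 1" by (simp add: h_def k_def)
  have "p * map_poly cnj p = k * (r * map_poly cnj r)"
    using eq a c unfolding \<open>h = Fract k 1\<close> by (simp add: p_def r_def eq_fract map_poly_cnj_mult ac_simps)
  then have "p = 0 \<and> r = 0" unfolding k_def by (rule poly_norm_form_anisotropic)
  then show ?thesis using a c by (auto simp: p_def r_def Zero_fract_def eq_fract)
qed

section \<open>The group \<open>\<G>\<close> as a projective quaternion group\<close>

lemma mat2_eq_iff: "mat2 a b c d = mat2 a' b' c' d' \<longleftrightarrow> a = a' \<and> b = b' \<and> c = c' \<and> d = d'"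
  by (auto simp: mat2_def vec_eq_iff forall_2)

lemma mat2_eta: "mat2 (M $ 1 $ 1) (M $ 1 $ 2) (M $ 2 $ 1) (M $ 2 $ 2) = M"
  by (simp add: mat2_def vec_eq_iff forall_2)

lemma pgl_class_eq_iff: "pgl_class M = pgl_class N \<longleftrightarrow> (\<exists>s. s \<noteq> 0 \<and> M = mat s ** N)"
proof
  assume "pgl_class M = pgl_class N"
  moreover have "M \<in> pgl_class M"
    unfolding pgl_class_eq by (auto intro!: exI [of _ 1] simp: matrix_mul_lid)
  ultimately show "\<exists>s. s \<noteq> 0 \<and> M = mat s ** N" by (auto simp: pgl_class_eq)
next
  assume "\<exists>s. s \<noteq> 0 \<and> M = mat s ** N"
  then obtain s where s: "s \<noteq> 0" "M = mat s ** N" by blast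
  have "mat e ** M \<in> pgl_class N" if "e \<noteq> 0" for e
    using s that by (auto simp: pgl_class_eq matrix_mul_assoc mat_mult_mat intro!: exI [of _ "e * s"])
  moreover have "mat e ** N \<in> pgl_class M" if "e \<noteq> 0" for e
    using s that by (auto simp: pgl_class_eq matrix_mul_assoc mat_mult_mat intro!: exI [of _ "e / s"])
  ultimately show "pgl_class M = pgl_class N" by (auto simp: pgl_class_eq)
qed

text \<open>The left multiplication matrix of the quaternion \<open>a + j c\<close>, where \<open>j\<^sup>2 = h\<close> and \<open>x j = j conj x\<close>.\<close>

definition quat :: "ratfun \<Rightarrow> ratfun \<Rightarrow> ratfun ^ 2 ^ 2" where
  "quat a c = mat2 a (h * conj_ratfun c) c (conj_ratfun a)"

lemma quat_mult:
  "quat a c ** quat a' c' = quat (a * a' + h * conj_ratfun c * c') (c * a' + conj_ratfun a * c')"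
  by (simp add: quat_def mat2_mult mat2_eq_iff algebra_simps)

text \<open>Only scalars from \<open>\<real>(z)\<close> are central in the quaternion algebra.\<close>

lemma mat_quat: "conj_ratfun s = s \<Longrightarrow> mat s ** quat a c = quat (s * a) (s * c)"
  by (simp add: quat_def mat_eq_mat2 mat2_mult mat2_eq_iff)

text \<open>The determinant of a quaternion is its norm, so this says that the quaternions form a division algebra.\<close>

lemma invertible_quat: "invertible (quat a c) \<longleftrightarrow> a \<noteq> 0 \<or> c \<noteq> 0"
proof -
  have "a * conj_ratfun a - h * conj_ratfun c * c = 0 \<longleftrightarrow> a = 0 \<and> c = 0"
  proof
    assume "a * conj_ratfun a - h * conj_ratfun c * c = 0"
    then have "a * conj_ratfun a = h * (c * conj_ratfun c)"
      by (metis eq_iff_diff_eq_0 mult.assoc mult.commute)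
    then show "a = 0 \<and> c = 0" by (rule norm_form_anisotropic)
  qed simp
  then show ?thesis by (auto simp: quat_def invertible_mat2)
qed

lemma mult_scrG: "x \<otimes>\<^bsub>scrG\<^esub> y = x \<otimes>\<^bsub>PGL2\<^esub> y" and one_scrG: "\<one>\<^bsub>scrG\<^esub> = \<one>\<^bsub>PGL2\<^esub>"
  by (simp_all add: scrG_def)

lemma tau_conj_pgl_class:
  assumes "invertible (mat2 a b c d)"
  shows "tau \<otimes>\<^bsub>PGL2\<^esub> pgl_class (mat2 a b c d) \<otimes>\<^bsub>PGL2\<^esub> tau = pgl_class (mat2 (h * d) (h * h * c) b (h * a))"
proof -
  define T where "T = mat2 0 h 1 0"
  have T: "tau = pgl_class T" "invertible T"
    using invertible_tau by (simp_all add: T_def tau_def h_def del: minus_fract)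
  have "T ** mat2 a b c d ** T = mat2 (h * d) (h * h * c) b (h * a)"
    by (simp add: T_def mat2_mult mat2_eq_iff)
  then show ?thesis
    unfolding T(1) using assms T(2) by (simp add: mult_PGL2 invertible_mult)
qed

lemma pgl_class_quat_in_scrG:
  assumes "a \<noteq> 0 \<or> c \<noteq> 0"
  shows "pgl_class (quat a c) \<in> carrier scrG"
proof -
  have inv: "invertible (quat a c)" using assms invertible_quat by blast
  have "pgl_class (mat2 (h * conj_ratfun a) (h * h * c) (h * conj_ratfun c) (h * a))
    = pgl_class (conj_mat (quat a c))"
    unfolding pgl_class_eq_iff
    by (rule exI [of _ h]) (simp add: quat_def conj_mat_mat2 mat_eq_mat2 mat2_mult mat2_eq_iff)
  then show ?thesis
    using inv tau_conj_pgl_class [OF inv [unfolded quat_def]]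
    by (auto simp: scrG_def carrier_PGL2 conj_pgl_class quat_def)
qed

text \<open>Hilbert 90 for complex conjugation on \<open>\<complex>(z)\<close>.  The resolvent \<open>1 + conj s\<close> solves the equation unless
  it is zero; in that case \<open>s = -1\<close>, and \<open>\<i>\<close> is a solution.\<close>

lemma hilbert_90:
  assumes "s * conj_ratfun s = 1"
  shows "\<exists>m. m \<noteq> 0 \<and> s * m = conj_ratfun m"
proof (cases "s = -1")
  case True
  then show ?thesis
    using cst_eq_iff [of \<i> 0]
    by (intro exI [of _ "cst \<i>"]) (simp add: cst_uminus)
next
  case False
  have "1 + conj_ratfun s \<noteq> 0"
    using False by (metis conj_ratfun_1 conj_ratfun_add conj_ratfun_conj_ratfun conj_ratfun_eq_0_iff eq_neg_iff_add_eq_0 add.commute)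
  then show ?thesis using assms
    by (intro exI [of _ "1 + conj_ratfun s"]) (simp add: algebra_simps)
qed

text \<open>Comparing \<open>\<tau> M \<tau>\<close> with the conjugate of \<open>M\<close> entry by entry gives a factor \<open>s\<close> of norm one, and
  Hilbert 90 provides a scalar \<open>m\<close> that absorbs it.\<close>

lemma scrG_imp_quat:
  assumes "A \<in> carrier scrG"
  obtains a c where "A = pgl_class (quat a c)" "a \<noteq> 0 \<or> c \<noteq> 0"
proof -
  obtain M where M: "invertible M" "A = pgl_class M" using assms by (auto simp: scrG_def carrier_PGL2)
  obtain a b c d where m: "M = mat2 a b c d" by (metis mat2_eta)
  have inv: "invertible (mat2 a b c d)" using M m by simp
  have "pgl_class (mat2 (h * d) (h * h * c) b (h * a)) = pgl_class (conj_mat (mat2 a b c d))"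
    using assms tau_conj_pgl_class [OF inv] by (simp add: scrG_def M m conj_pgl_class)
  then obtain s0 where s0: "mat2 (h * d) (h * h * c) b (h * a) = mat s0 ** conj_mat (mat2 a b c d)"
    unfolding pgl_class_eq_iff by blast
  \<comment> \<open>\<open>\<tau>\<close> squares to the scalar \<open>h\<close>, so dividing by \<open>h\<close> turns \<open>\<tau> M \<tau>\<close> into the conjugate \<open>\<tau> M \<tau>\<^sup>-\<^sup>1\<close>.\<close>
  define s where "s = s0 / h"
  have s: "d = s * conj_ratfun a" "a = s * conj_ratfun d" "h * c = s * conj_ratfun b" "b = h * s * conj_ratfun c"
    using s0 by (simp_all add: s_def conj_mat_mat2 mat_eq_mat2 mat2_mult mat2_eq_iff divide_simps)
       (auto simp: algebra_simps)
  have "a = s * conj_ratfun s * a"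
    by (metis s(1,2) conj_ratfun_mult conj_ratfun_conj_ratfun mult.assoc)
  moreover have "c = s * conj_ratfun s * c"
  proof -
    have "conj_ratfun b = h * conj_ratfun s * c" by (subst s(4)) simp
    then have "h * c = h * (s * conj_ratfun s * c)" using s(3) by (simp only: ac_simps)
    then show ?thesis using mult_left_cancel [OF h_nonzero] by blast
  qed
  moreover have ac: "a \<noteq> 0 \<or> c \<noteq> 0" using inv by (auto simp: invertible_mat2)
  ultimately have "s * conj_ratfun s = 1" by (metis mult_cancel_right2 mult.commute)
  then obtain m where mm: "m \<noteq> 0" "s * m = conj_ratfun m" using hilbert_90 by blast
  have "mat m ** mat2 a b c d = quat (m * a) (m * c)"
  proof -
    have "m * b = h * (s * m * conj_ratfun c)" by (subst s(4)) (simp only: ac_simps)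
    moreover have "m * d = s * m * conj_ratfun a" by (subst s(1)) (simp only: ac_simps)
    ultimately show ?thesis
      by (simp add: mm(2) quat_def mat_eq_mat2 mat2_mult mat2_eq_iff)
  qed
  then have "pgl_class (quat (m * a) (m * c)) = A"
    unfolding M m pgl_class_eq_iff using mm by metis
  then show thesis using that ac mm by (metis mult_eq_0_iff)
qed

section \<open>Finite order forces a constant norm\<close>

text \<open>The Lucas sequence \<open>U\<close> of \<open>x\<^sup>2 = 2 x - \<nu>\<close>, as polynomials in \<open>\<nu>\<close>: in every commutative ring
  \<open>x\<^sup>2 = 2 x - \<nu>\<close> implies \<open>x\<^bsup>m+1\<^esup> = U\<^bsub>m+1\<^esub> x - \<nu> U\<^bsub>m\<^esub>\<close>.\<close>

fun lucas :: "nat \<Rightarrow> complex poly" where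
  "lucas 0 = 0"
| "lucas (Suc 0) = 1"
| "lucas (Suc (Suc m)) = Polynomial.smult 2 (lucas (Suc m)) - pCons 0 (lucas m)"

text \<open>At \<open>\<nu> = 0\<close> the recurrence is doubling, so the constant coefficient is a power of two.\<close>

lemma lucas_nonzero: "lucas (Suc m) \<noteq> 0"
proof -
  have "poly (lucas (Suc m)) 0 = 2 ^ m" by (induction m rule: induct_nat_012) simp_all
  then show ?thesis by force
qed

lemma ev_lucas:
  "ev (lucas (Suc (Suc m))) x = 2 * ev (lucas (Suc m)) x - x * ev (lucas m) x"
proof -
  have "lucas (Suc (Suc m)) + pCons 0 (lucas m) = Polynomial.smult 2 (lucas (Suc m))" by simp
  then have "ev (lucas (Suc (Suc m))) x + x * ev (lucas m) x = cst 2 * ev (lucas (Suc m)) x"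
    by (metis add.left_neutral cst_0 ev_add ev_pCons ev_smult)
  then show ?thesis by (simp add: cst_2 algebra_simps)
qed

text \<open>By Cayley and Hamilton a matrix of trace \<open>2\<close> and determinant \<open>\<nu>\<close> satisfies \<open>M\<^sup>2 = 2 M - \<nu>\<close>.\<close>

lemma pgl_class_pow:
  assumes "invertible (mat2 a b c d)" "a + d = 2" and nu: "nu = a * d - b * c"
  defines "P \<equiv> \<lambda>m. ev (lucas m) nu"
  shows "invertible (mat2 (P (Suc m) * a - nu * P m) (P (Suc m) * b) (P (Suc m) * c) (P (Suc m) * d - nu * P m))
   \<and> pgl_class (mat2 a b c d) [^]\<^bsub>PGL2\<^esub> Suc m =
     pgl_class (mat2 (P (Suc m) * a - nu * P m) (P (Suc m) * b) (P (Suc m) * c) (P (Suc m) * d - nu * P m))"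
proof (induction m)
  case 0
  interpret group "PGL2 :: (ratfun ^ 2 ^ 2) set monoid" by (rule group_PGL2)
  have "pgl_class (mat2 a b c d) \<in> carrier PGL2" using assms by (auto simp: carrier_PGL2)
  moreover have "P 0 = 0" "P (Suc 0) = 1" by (simp_all add: P_def one_pCons)
  ultimately show ?case using assms(1) by simp
next
  case (Suc m)
  interpret group "PGL2 :: (ratfun ^ 2 ^ 2) set monoid" by (rule group_PGL2)
  let ?M = "\<lambda>m. mat2 (P (Suc m) * a - nu * P m) (P (Suc m) * b) (P (Suc m) * c) (P (Suc m) * d - nu * P m)"
  have rec: "P (Suc (Suc m)) = 2 * P (Suc m) - nu * P m" unfolding P_def by (rule ev_lucas)
  have d: "d = 2 - a" using assms(2) by (simp add: algebra_simps)
  have "?M m ** mat2 a b c d = ?M (Suc m)"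
    unfolding mat2_mult mat2_eq_iff rec nu d by (simp add: algebra_simps)
  then show ?case
    using Suc assms(1) by (metis invertible_mult mult_PGL2 nat_pow_Suc)
qed

lemma pow_scrG: "A [^]\<^bsub>scrG\<^esub> (n :: nat) = A [^]\<^bsub>PGL2\<^esub> n"
  by (simp add: scrG_def nat_pow_def)

text \<open>If \<open>p M - q\<close> is scalar for scalars \<open>p\<close> and \<open>q\<close>, and \<open>M\<close> is not scalar, then \<open>p = 0\<close>.  For
  \<open>M\<^sup>n\<close> with \<open>n > 0\<close> the factor \<open>p\<close> is a nonzero complex polynomial in the determinant.\<close>

lemma finite_order_imp_constant_norm:
  assumes "invertible (mat2 a b c d)" "a + d = 2"
    and pow: "pgl_class (mat2 a b c d) [^]\<^bsub>PGL2\<^esub> (n :: nat) = \<one>\<^bsub>PGL2\<^esub>" and "n \<noteq> 0"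
    and ne: "pgl_class (mat2 a b c d) \<noteq> \<one>\<^bsub>PGL2\<^esub>"
  shows "\<exists>v. a * d - b * c = cst v"
proof -
  define nu where "nu = a * d - b * c"
  obtain m where n: "n = Suc m" using \<open>n \<noteq> 0\<close> not0_implies_Suc by blast
  define p q where "p = ev (lucas (Suc m)) nu" and "q = nu * ev (lucas m) nu"
  have "pgl_class (mat2 (p * a - q) (p * b) (p * c) (p * d - q)) = pgl_class (mat 1)"
    using pgl_class_pow [OF assms(1,2) nu_def, of m] pow by (simp add: n p_def q_def one_PGL2)
  then obtain s where "mat2 (p * a - q) (p * b) (p * c) (p * d - q) = mat s ** mat 1"
    unfolding pgl_class_eq_iff by blast
  then have "mat2 (p * a - q) (p * b) (p * c) (p * d - q) = mat s"
    by (simp only: mat_mult_mat mult_1_right)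
  then have *: "p * b = 0" "p * c = 0" "p * a = p * d"
    by (auto simp: mat_eq_mat2 mat2_eq_iff)
  have "p = 0"
  proof (rule ccontr)
    assume "p \<noteq> 0"
    then have "mat2 a b c d = mat a" using * by (simp add: mat_eq_mat2 mat2_eq_iff)
    then show False using ne pgl_class_mat [of a] assms(1) by (auto simp: mat_eq_mat2 invertible_mat2)
  qed
  then show ?thesis
    using root_imp_constant [OF lucas_nonzero [of m], of nu] by (simp add: p_def nu_def)
qed

section \<open>Conjugation to a rotation\<close>

lemma trace_free_involution:
  assumes "invertible (mat2 a b c (- a))"
  shows "pgl_class (mat2 a b c (- a)) \<otimes>\<^bsub>PGL2\<^esub> pgl_class (mat2 a b c (- a)) = \<one>\<^bsub>PGL2\<^esub>"
proof -
  have "mat2 a b c (- a) ** mat2 a b c (- a) = mat (a * a + b * c)"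
    by (simp add: mat2_mult mat_eq_mat2 mat2_eq_iff algebra_simps)
  moreover have "a * a + b * c \<noteq> 0"
  proof -
    have "a * - a - b * c = - (a * a + b * c)" by simp
    then show ?thesis using assms by (simp only: invertible_mat2 neg_equal_0_iff_equal) simp
  qed
  ultimately show ?thesis using assms by (simp add: mult_PGL2 pgl_class_mat)
qed

lemma pgl_class_diag_rotation:
  assumes "cmod z = 1" "x \<noteq> 0" "y = x * cst z"
  shows "\<exists>\<theta>. pgl_class (mat2 x 0 0 y) = rotation \<theta>"
proof -
  obtain t where "z = exp (\<i> * of_real t)"
    using assms(1) complex_unimodular_polar by (metis cis_conv_exp cis.ctr)
  then have "mat2 x 0 0 y = mat x ** mat2 1 0 0 (Fract [:exp (\<i> * of_real t):] 1)"
    using assms by (simp add: cst_def mat_eq_mat2 mat2_mult mat2_eq_iff)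
  then show ?thesis unfolding rotation_def pgl_class_eq_iff using assms(2) by blast
qed

text \<open>Put \<open>N = M - 1\<close> and \<open>i = \<i> k\<close>, so that \<open>N\<^sup>2 = i\<^sup>2\<close> is central.  Then \<open>N + i\<close> intertwines the two roots:
  \<open>(N + i) N = i\<^sup>2 + i N = i (N + i)\<close>.  It serves as the conjugating quaternion unless it is zero; in that
  case \<open>N = -i\<close>, and \<open>j\<close> conjugates \<open>-i\<close> to \<open>i\<close>.\<close>

lemma quat_conjugate_to_constant:
  assumes tr: "a + conj_ratfun a = 2" and nu: "a * conj_ratfun a - h * (c * conj_ratfun c) = cst v"
    and k: "v = 1 + of_real k ^ 2"
  shows "\<exists>b e. (b \<noteq> 0 \<or> e \<noteq> 0) \<and> quat b e ** quat a c = quat (1 + cst (\<i> * of_real k)) 0 ** quat b e"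
proof -
  define i where "i = cst (\<i> * of_real k)"
  have ci: "conj_ratfun i = - i" by (simp add: i_def cst_uminus)
  have "i * i = - cst (of_real k ^ 2)"
    by (simp add: i_def power2_eq_square algebra_simps flip: cst_mult cst_uminus)
  then have "cst v = 1 - i * i" by (simp add: k cst_add)
  then have nu': "h * (c * conj_ratfun c) = a * conj_ratfun a - 1 + i * i"
    using nu by (simp add: algebra_simps)
  have ca: "conj_ratfun a = 2 - a" using tr by (simp add: algebra_simps)
  show ?thesis
  proof (cases "a - 1 + i = 0 \<and> c = 0")
    case True
    then have "a = 1 - i" by (simp add: algebra_simps)
    then have "quat 0 1 ** quat a c = quat (1 + i) 0 ** quat 0 1"
      using True by (simp add: quat_mult ci)
    then show ?thesis unfolding i_def by (metis zero_neq_one)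
  next
    case False
    have "(a - 1 + i) * a + h * conj_ratfun c * c = (1 + i) * (a - 1 + i)"
    proof -
      have "h * conj_ratfun c * c = h * (c * conj_ratfun c)" by simp
      then show ?thesis unfolding nu' ca by (simp add: algebra_simps)
    qed
    moreover have "c * a + conj_ratfun (a - 1 + i) * c = conj_ratfun (1 + i) * c"
      by (simp add: ci ca algebra_simps)
    ultimately have "quat (a - 1 + i) c ** quat a c = quat (1 + i) 0 ** quat (a - 1 + i) c"
      by (simp add: quat_mult)
    then show ?thesis using False unfolding i_def by blast
  qed
qed

theorem lemma5p34:
  fixes A :: "(complex poly fract ^ 2 ^ 2) set" and n :: nat
  assumes "A \<in> carrier scrG"
    and "group.ord scrG A = n" and "n \<noteq> 0" and "n \<noteq> 2"
  shows "\<exists>\<theta> :: real. \<exists>B \<in> carrier scrG.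
    B \<otimes>\<^bsub>scrG\<^esub> A \<otimes>\<^bsub>scrG\<^esub> inv\<^bsub>scrG\<^esub> B = rotation \<theta>"
proof -
  interpret G: group scrG by (rule group_scrG)
  show ?thesis
  proof (cases "A = \<one>\<^bsub>scrG\<^esub>")
    case True
    have "rotation 0 = \<one>\<^bsub>scrG\<^esub>"
      by (simp add: rotation_def one_scrG one_PGL2 mat_eq_mat2 cst_def [symmetric])
    then show ?thesis using True by (intro exI [of _ 0] bexI [of _ "\<one>\<^bsub>scrG\<^esub>"]) simp_all
  next
    case False
    have pow: "A [^]\<^bsub>scrG\<^esub> n = \<one>\<^bsub>scrG\<^esub>" using G.pow_ord_eq_1 assms by metis
    obtain a0 c0 where A0: "A = pgl_class (quat a0 c0)" "a0 \<noteq> 0 \<or> c0 \<noteq> 0"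
      using scrG_imp_quat assms(1) by blast
    define t where "t = a0 + conj_ratfun a0"
    have "t \<noteq> 0"
    proof
      assume "t = 0"
      then have "conj_ratfun a0 = - a0" by (simp add: t_def eq_neg_iff_add_eq_0 add.commute)
      then have "A \<otimes>\<^bsub>scrG\<^esub> A = \<one>\<^bsub>scrG\<^esub>"
        using A0 invertible_quat [of a0 c0] trace_free_involution [of a0 _ c0]
        by (simp add: quat_def mult_scrG one_scrG)
      then have "A [^]\<^bsub>scrG\<^esub> (2 :: nat) = \<one>\<^bsub>scrG\<^esub>"
        using assms(1) by (simp add: numeral_2_eq_2)
      then have "n dvd 2" using G.pow_eq_id assms by blast
      then have "n = 1" using assms
        by (auto dest!: dvd_imp_le)
      then show False using False pow assms(1) by simp
    qed
    have conj2: "conj_ratfun 2 = 2" by (metis conj_ratfun_1 conj_ratfun_add one_add_one)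
    \<comment> \<open>the representative of trace \<open>2\<close>, for which \<open>M\<^sup>2 = 2 M - \<nu>\<close>\<close>
    define a c where "a = 2 / t * a0" and "c = 2 / t * c0"
    have ct: "conj_ratfun t = t" by (simp add: t_def add.commute)
    have two: "(2 :: ratfun) \<noteq> 0" using cst_eq_iff [of 2 0] by (simp add: cst_2)
    have "quat a c = mat (2 / t) ** quat a0 c0"
      unfolding a_def c_def by (rule mat_quat [symmetric]) (simp add: ct conj2)
    then have "pgl_class (quat a c) = A"
      unfolding A0 pgl_class_eq_iff using \<open>t \<noteq> 0\<close> by (intro exI [of _ "2 / t"]) (simp add: two)
    then have A: "A = pgl_class (quat a c)" ..
    have ac: "a \<noteq> 0 \<or> c \<noteq> 0" using A0 \<open>t \<noteq> 0\<close> two by (simp add: a_def c_def)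
    have tr: "a + conj_ratfun a = 2"
    proof -
      have "a + conj_ratfun a = 2 / t * (a0 + conj_ratfun a0)"
        by (simp add: a_def ct conj2 distrib_left)
      also have "\<dots> = 2 / t * t" by (simp only: t_def)
      finally show ?thesis using \<open>t \<noteq> 0\<close> by simp
    qed
    define nu where "nu = a * conj_ratfun a - h * (c * conj_ratfun c)"
    obtain v where v: "nu = cst v"
      using finite_order_imp_constant_norm [of a "h * conj_ratfun c" c "conj_ratfun a" n]
        tr pow False assms(3) ac invertible_quat [of a c]
      unfolding A by (auto simp: quat_def pow_scrG one_scrG nu_def ac_simps)
    have "conj_ratfun nu = nu" by (simp add: nu_def ac_simps)
    then have "cnj v = v" by (simp add: v)
    then obtain r where r: "v = of_real r" by (metis Reals_cnj_iff Reals_cases)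
    have "r > 1"
    proof (rule ccontr)
      assume "\<not> r > 1"
      define e where "e = cst (of_real (sqrt (1 - r)))"
      \<comment> \<open>The product \<open>(M - 1 + e) (M - 1 - e)\<close> is zero, and already the norm of its first factor is.\<close>
      have ce: "conj_ratfun e = e" by (simp add: e_def)
      have "e * e = cst (of_real (1 - r))"
        unfolding e_def cst_mult [symmetric] of_real_mult [symmetric]
        using \<open>\<not> r > 1\<close> by simp
      also have "\<dots> = 1 - nu"
        unfolding v r using cst_add [of "of_real (1 - r)" "of_real r"] by (simp add: algebra_simps)
      finally have ee: "e * e = 1 - nu" .
      have ca: "conj_ratfun a = 2 - a" using tr by (simp add: algebra_simps)
      have "(a - 1 + e) * conj_ratfun (a - 1 + e) = h * (c * conj_ratfun c)"
        using ee by (simp add: ce ca nu_def algebra_simps)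
      then have "a - 1 + e = 0" "c = 0" using norm_form_anisotropic by blast+
      then have "a = 1 - e" by (simp add: algebra_simps)
      then have "conj_ratfun a = a" by (simp add: ce)
      then have "quat a c = mat a" "a \<noteq> 0"
        using ac \<open>c = 0\<close> by (simp_all add: quat_def mat_eq_mat2)
      then show False using False A pgl_class_mat by (auto simp: one_scrG)
    qed
    define k where "k = sqrt (r - 1)"
    have "k\<^sup>2 = r - 1" using \<open>r > 1\<close> by (simp add: k_def)
    then have k: "v = 1 + of_real k ^ 2" unfolding r of_real_power [symmetric] by simp
    obtain b e where be: "b \<noteq> 0 \<or> e \<noteq> 0"
      "quat b e ** quat a c = quat (1 + cst (\<i> * of_real k)) 0 ** quat b e"
      using quat_conjugate_to_constant [OF tr v [unfolded nu_def] k] by (elim exE conjE)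
    define w where "w = 1 + \<i> * of_real k"
    have w: "1 + cst (\<i> * of_real k) = cst w" "w \<noteq> 0" by (simp_all add: w_def cst_add complex_eq_iff)
    define B where "B = pgl_class (quat b e)"
    define D where "D = pgl_class (quat (cst w) 0)"
    have cw: "cst w \<noteq> 0" using w(2) cst_eq_iff [of w 0] by simp
    have B: "B \<in> carrier scrG" and D: "D \<in> carrier scrG"
      using be cw by (auto simp: B_def D_def intro: pgl_class_quat_in_scrG)
    have "B \<otimes>\<^bsub>scrG\<^esub> A = D \<otimes>\<^bsub>scrG\<^esub> B"
      using be ac cw by (simp add: A B_def D_def mult_scrG mult_PGL2 invertible_quat w)
    then have "B \<otimes>\<^bsub>scrG\<^esub> A \<otimes>\<^bsub>scrG\<^esub> inv\<^bsub>scrG\<^esub> B = D"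
      using B D by (simp add: G.m_assoc)
    moreover have "\<exists>\<theta>. D = rotation \<theta>"
      unfolding D_def quat_def
      using pgl_class_diag_rotation [of "cnj w / w" "cst w" "cst (cnj w)"] w(2) cw
      by (simp add: norm_divide cst_mult [symmetric])
    ultimately show ?thesis using B by metis
  qed
qed

end
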